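(* Let $X$ be a normed vector space over $\mathbb{K}\in\{\mathbb{R},\mathbb{C}\}$, let $d\geq 1$, $m\in\mathbb{N}$, $p\in(0,\infty)$ and $\mu\in\mathbb{N}$ with $\mu\geq 1$. Let $T=(T_1,\dots,T_d)\in B(X)^d$ be a tuple of commuting bounded linear operators which is both an $(m,p)$-isometry and a $(\mu,\infty)$-isometry. Then: (i) For all $j\in\{1,\dots,d\}$ and all $x\in X$, the sequence $n\mapsto\|T_j^n x\|$ becomes constant for $n\geq m$, i.e. $\|T_j^n x\|=\|T_j^m x\|$ for all $n\geq m$. (ii) The tuple $(T_1^m,\dots,T_d^m)$ is a $(1,p)$-isometry, that is, $$\sum_{j=1}^d\|T_j^m x\|^p=\|x\|^p\quad\text{for all }x\in X.$$ (iii) For any $(n_1,\dots,n_d)\in\mathbb{N}^d$ with $n_j\geq m$ for all $j$, the operator $\sum_{j=1}^d T_j^{n_j}$ is an isometry, that is, $$\Big\|\sum_{j=1}^d T_j^{n_j}x\Big\|=\|x\|\quad\text{for all }x\in X.$$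
   Context: $\mathbb{N}$ denotes the natural numbers including $0$. $B(X)$ is the algebra of bounded linear operators on $X$. For a multi-index $\alpha=(\alpha_1,\dots,\alpha_d)\in\mathbb{N}^d$ put $|\alpha|=\alpha_1+\cdots+\alpha_d$, $\alpha!=\alpha_1!\cdots\alpha_d!$, and $T^\alpha=T_1^{\alpha_1}\cdots T_d^{\alpha_d}$, where $T_j^0=I$ is the identity. A commuting tuple $T=(T_1,\dots,T_d)$ of linear operators on $X$ is an $(m,p)$-isometry (or $(m,p)$-isometric tuple), for $m\in\mathbb{N}$ and $p\in(0,\infty)$, if $$\sum_{k=0}^m(-1)^{m-k}\binom{m}{k}\sum_{|\alpha|=k}\frac{k!}{\alpha!}\|T^\alpha x\|^p=0\quad\text{for all }x\in X.$$ A commuting tuple $T\in B(X)^d$ is a $(\mu,\infty)$-isometry (or $(\mu,\infty)$-isometric tuple), for $\mu\in\mathbb{N}$, $\mu\geq 1$, if $$\max_{0\leq|\alpha|\leq\mu,\ |\alpha|\text{ even}}\|T^\alpha x\|=\max_{0\leq|\alpha|\leq\mu,\ |\alpha|\text{ odd}}\|T^\alpha x\|\quad\text{for all }x\in X.$$ *)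

theory Defs
  imports Complex_Main "HOL-Library.FuncSet"
begin

text \<open>
  The scalar field \<open>\<K>\<close> is a type of class \<^class>\<open>real_normed_field\<close>, whose instances include
  \<^typ>\<open>real\<close> and \<^typ>\<open>complex\<close> (and, by Gelfand-Mazur, no others up to isomorphism).
  The metric and real structure of \<open>X\<close> come from \<^class>\<open>real_normed_vector\<close>; the scalar
  multiplication by \<open>\<K>\<close> is required to extend the real one. For \<open>\<K> = \<real>\<close> this forces
  \<open>scale\<close> to be \<^const>\<open>scaleR\<close>.
\<close>

locale normed_space_over = vector_space scale
  for scale :: "'k::real_normed_field \<Rightarrow> 'a::real_normed_vector \<Rightarrow> 'a" +
  assumes scale_of_real: "scale (of_real r) x = r *\<^sub>R x"
    and norm_scale: "norm (scale c x) = norm c * norm x"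

lemma normed_space_over_scaleR:
  "normed_space_over (scaleR :: real \<Rightarrow> 'a::real_normed_vector \<Rightarrow> 'a)"
  by unfold_locales (simp_all add: algebra_simps)

lemma normed_space_over_complex:
  "normed_space_over ((*) :: complex \<Rightarrow> complex \<Rightarrow> complex)"
  by unfold_locales (simp_all add: algebra_simps norm_mult scaleR_conv_of_real)

definition bounded_operator ::
    "('k::real_normed_field \<Rightarrow> 'a::real_normed_vector \<Rightarrow> 'a) \<Rightarrow> ('a \<Rightarrow> 'a) \<Rightarrow> bool" where
  "bounded_operator scale A \<longleftrightarrow>
     Vector_Spaces.linear scale scale A \<and> (\<exists>C. \<forall>x. norm (A x) \<le> C * norm x)"

text \<open>
  A \<open>d\<close>-tuple of operators is a function \<open>T\<close> on \<^typ>\<open>nat\<close> of which only the values at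
  \<open>1, \<dots>, d\<close> matter. Multi-indices are extensional functions on \<open>{1..d}\<close>, so that each
  element of \<open>\<nat>\<^sup>d\<close> is represented exactly once in the sums and maxima below.
\<close>

definition commuting_tuple :: "nat \<Rightarrow> (nat \<Rightarrow> 'a \<Rightarrow> 'a) \<Rightarrow> bool" where
  "commuting_tuple d T \<longleftrightarrow> (\<forall>i\<in>{1..d}. \<forall>j\<in>{1..d}. T i \<circ> T j = T j \<circ> T i)"

definition multi_indices :: "nat \<Rightarrow> (nat \<Rightarrow> nat) set" where
  "multi_indices d = {1..d} \<rightarrow>\<^sub>E UNIV"

definition mi_abs :: "nat \<Rightarrow> (nat \<Rightarrow> nat) \<Rightarrow> nat" where
  "mi_abs d \<alpha> = (\<Sum>j=1..d. \<alpha> j)"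

definition mi_fact :: "nat \<Rightarrow> (nat \<Rightarrow> nat) \<Rightarrow> real" where
  "mi_fact d \<alpha> = (\<Prod>j=1..d. fact (\<alpha> j))"

definition tuple_power :: "nat \<Rightarrow> (nat \<Rightarrow> 'a \<Rightarrow> 'a) \<Rightarrow> (nat \<Rightarrow> nat) \<Rightarrow> 'a \<Rightarrow> 'a" where
  "tuple_power d T \<alpha> = foldr (\<lambda>j S. (T j ^^ \<alpha> j) \<circ> S) [1..<Suc d] id"

definition mp_isometric_tuple ::
    "('k::real_normed_field \<Rightarrow> 'a::real_normed_vector \<Rightarrow> 'a) \<Rightarrow>
     nat \<Rightarrow> nat \<Rightarrow> real \<Rightarrow> (nat \<Rightarrow> 'a \<Rightarrow> 'a) \<Rightarrow> bool" where
  "mp_isometric_tuple scale d m p T \<longleftrightarrow>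
     (\<forall>j\<in>{1..d}. Vector_Spaces.linear scale scale (T j)) \<and>
     commuting_tuple d T \<and>
     (\<forall>x. (\<Sum>k=0..m. (-1) ^ (m - k) * real (m choose k) *
            (\<Sum>\<alpha>\<in>{\<alpha> \<in> multi_indices d. mi_abs d \<alpha> = k}.
               fact k / mi_fact d \<alpha> * norm (tuple_power d T \<alpha> x) powr p)) = 0)"

definition infty_isometric_tuple ::
    "('k::real_normed_field \<Rightarrow> 'a::real_normed_vector \<Rightarrow> 'a) \<Rightarrow>
     nat \<Rightarrow> nat \<Rightarrow> (nat \<Rightarrow> 'a \<Rightarrow> 'a) \<Rightarrow> bool" where
  "infty_isometric_tuple scale d \<mu> T \<longleftrightarrow>
     (\<forall>j\<in>{1..d}. bounded_operator scale (T j)) \<and>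
     commuting_tuple d T \<and>
     (\<forall>x. Max ((\<lambda>\<alpha>. norm (tuple_power d T \<alpha> x)) `
                {\<alpha> \<in> multi_indices d. mi_abs d \<alpha> \<le> \<mu> \<and> even (mi_abs d \<alpha>)}) =
          Max ((\<lambda>\<alpha>. norm (tuple_power d T \<alpha> x)) `
                {\<alpha> \<in> multi_indices d. mi_abs d \<alpha> \<le> \<mu> \<and> odd (mi_abs d \<alpha>)}))"

end

theory Submission imports Defs begin

text \<open>
  Put \<open>q\<^sub>n(x) = \<Sum>\<^bsub>|\<alpha>| = n\<^esub> n!/\<alpha>! \<parallel>T\<^sup>\<alpha> x\<parallel>\<^sup>p\<close>. The recursion
  \<open>q\<^bsub>n+1\<^esub>(x) = \<Sum>\<^sub>j q\<^sub>n(T\<^sub>j x)\<close> turns the \<open>(m, p)\<close>-condition into the statement that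
  \<open>n \<mapsto> q\<^sub>n(x)\<close> has vanishing \<open>m\<close>-th differences, i.e. is a polynomial of degree less than \<open>m\<close>.
  Put \<open>A(x) = max\<^bsub>|\<alpha>| \<le> \<mu>\<^esub> \<parallel>T\<^sup>\<alpha> x\<parallel>\<close>. Under the \<open>(\<mu>, \<infinity>)\<close>-condition this maximum is attained at
  multi-indices of both parities, hence at one of length less than \<open>\<mu>\<close> and at one of positive
  length; therefore \<open>A(x) = max\<^sub>j A(T\<^sub>j x)\<close>. In particular all orbits are bounded.

  The two properties are played against each other three times.

  \<^item> Growth (\<open>powers_annihilate\<close>). Suppose \<open>y = T\<^sub>i\<^sup>m T\<^sub>j\<^sup>m x \<noteq> 0\<close> with \<open>i \<noteq> j\<close>. By invariance of \<open>A\<close>,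
    there is an \<open>l\<close> with \<open>A(T\<^sub>l\<^sup>n y) = A(y) > 0\<close> for all \<open>n\<close>. Since \<open>l\<close> differs from \<open>i\<close> or from \<open>j\<close>,
    the binomially many orderings of \<open>m\<close> steps in that direction and \<open>n - m\<close> steps in direction
    \<open>l\<close> force growth of order \<open>n\<^sup>m\<close> on \<open>q\<^sub>n + \<dots> + q\<^bsub>n+\<mu>\<^esub>\<close>, a polynomial of degree less than \<open>m\<close>.
    So \<open>y = 0\<close>.

  \<^item> Boundedness (\<open>q_invariant\<close>). On the range of \<open>T\<^sub>j\<^sup>m\<close> the other operators are nilpotent. By
    induction on the order of nilpotency, \<open>k \<mapsto> \<parallel>T\<^sub>j\<^sup>k y\<parallel>\<^sup>p\<close> is polynomial there; being bounded, it is
    constant. This is (i).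

  \<^item> Extrapolation (\<open>q_decomposition\<close>). The difference between \<open>q\<^sub>n(x)\<close> and \<open>\<Sum>\<^sub>j q\<^sub>n(T\<^sub>j\<^sup>m x)\<close> vanishes
    whenever \<open>x\<close> lies in the range of some \<open>T\<^sub>j\<^sup>m\<close>. As every long word in the operators contains
    some \<open>T\<^sub>j\<^sup>m\<close>, the recursion makes it vanish for all large \<open>n\<close>, and a polynomial that
    vanishes for large \<open>n\<close> vanishes at \<open>n = 0\<close>. This is (ii).

  Finally, (iii) is (ii) applied to \<open>y = \<Sum>\<^sub>j T\<^sub>j\<^bsup>n(j)\<^esup> x\<close>: annihilation leaves only
  \<open>T\<^sub>i\<^sup>m y = T\<^sub>i\<^bsup>m+n(i)\<^esup> x\<close>, whose norm is \<open>\<parallel>T\<^sub>i\<^sup>m x\<parallel>\<close> by (i).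

  In all three, \<open>backward_induction\<close> supplies the fact that a long multi-index has a large component.
\<close>

section \<open>Finite differences\<close>

definition forward_diff :: "(nat \<Rightarrow> real) \<Rightarrow> nat \<Rightarrow> real" where
  "forward_diff f n = f (Suc n) - f n"

lemma iterated_forward_diff_Suc:
  "(forward_diff ^^ Suc m) f n = (forward_diff ^^ m) f (Suc n) - (forward_diff ^^ m) f n"
  by (simp add: forward_diff_def)

lemma iterated_forward_diff:
  "(forward_diff ^^ m) f n = (\<Sum>k=0..m. (-1) ^ (m - k) * real (m choose k) * f (n + k))"
proof (induction m arbitrary: n)
  case 0
  show ?case by simp
next
  case (Suc m)
  \<comment> \<open>With the signs absorbed into \<open>g\<close>, the induction step is Pascal's rule for unsigned sums.\<close>
  define g where "g k = (-1) ^ (Suc m - k) * f (n + k)" for k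
  have a: "(\<Sum>k=0..m. (-1) ^ (m - k) * real (m choose k) * f (Suc n + k))
      = (\<Sum>k=0..m. real (m choose k) * g (Suc k))"
    by (intro sum.cong) (auto simp: g_def)
  have b: "(\<Sum>k=0..m. (-1) ^ (m - k) * real (m choose k) * f (n + k))
      = - (\<Sum>k=0..m. real (m choose k) * g k)"
    unfolding sum_negf[symmetric] by (intro sum.cong) (auto simp: g_def Suc_diff_le)
  have c: "(\<Sum>k=0..m. real (m choose k) * g k) = g 0 + (\<Sum>k=0..m. real (m choose Suc k) * g (Suc k))"
  proof -
    have "(\<Sum>k=0..Suc m. real (m choose k) * g k)
        = g 0 + (\<Sum>k=0..m. real (m choose Suc k) * g (Suc k))"
      by (subst sum.atLeast0_atMost_Suc_shift) simp
    then show ?thesis by (simp add: binomial_eq_0)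
  qed
  have d: "(\<Sum>k=0..Suc m. real (Suc m choose k) * g k)
      = g 0 + (\<Sum>k=0..m. real (Suc m choose Suc k) * g (Suc k))"
    by (subst sum.atLeast0_atMost_Suc_shift) simp
  have "(forward_diff ^^ Suc m) f n
      = (\<Sum>k=0..m. real (m choose k) * g (Suc k)) + (\<Sum>k=0..m. real (m choose k) * g k)"
    unfolding iterated_forward_diff_Suc Suc.IH a b by simp
  also have "\<dots> = (\<Sum>k=0..Suc m. real (Suc m choose k) * g k)"
    unfolding c d by (simp add: algebra_simps sum.distrib)
  finally show ?case by (simp add: g_def mult_ac)
qed

lemma iterated_forward_diff_sum:
  "(forward_diff ^^ m) (\<lambda>n. \<Sum>i\<in>I. f i n) n = (\<Sum>i\<in>I. (forward_diff ^^ m) (f i) n)"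
  unfolding iterated_forward_diff by (simp add: sum_distrib_left sum.swap[of _ _ I])

lemma iterated_forward_diff_diff:
  "(forward_diff ^^ m) (\<lambda>n. f n - g n) n = (forward_diff ^^ m) f n - (forward_diff ^^ m) g n"
  unfolding iterated_forward_diff by (simp add: right_diff_distrib sum_subtractf)

lemma iterated_forward_diff_cmult:
  "(forward_diff ^^ m) (\<lambda>n. c * f n) n = c * (forward_diff ^^ m) f n"
  unfolding iterated_forward_diff by (simp add: sum_distrib_left mult_ac)

lemma iterated_forward_diff_shift:
  "(forward_diff ^^ m) (\<lambda>n. f (n + k)) n = (forward_diff ^^ m) f (n + k)"
  unfolding iterated_forward_diff by (simp add: add_ac)

lemma iterated_forward_diff_binomial:
  "k \<le> m \<Longrightarrow> (forward_diff ^^ k) (\<lambda>n. real (n choose m)) n = real (n choose (m - k))"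
proof (induction k arbitrary: n)
  case (Suc k)
  obtain r where r: "m - k = Suc r" "m - Suc k = r"
    using Suc.prems by (metis Suc_diff_Suc Suc_le_lessD)
  show ?case using Suc.IH Suc.prems r by (simp add: forward_diff_def)
qed simp

text \<open>
  By induction on the order, the difference sequence is constant, so the sequence is affine; a
  bounded affine sequence has slope zero.
\<close>

lemma bounded_polynomial_sequence_constant:
  assumes "\<And>n. (forward_diff ^^ k) f n = 0" and "\<And>n. \<bar>f n\<bar> \<le> C"
  shows "f (Suc n) = f n"
  using assms
proof (induction k arbitrary: f C n)
  case 0
  then show ?case by simp
next
  case (Suc k)
  have bd: "\<bar>forward_diff f n\<bar> \<le> 2 * C" for n
    using Suc.prems(2)[of n] Suc.prems(2)[of "Suc n"] unfolding forward_diff_def by linarith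
  have "(forward_diff ^^ k) (forward_diff f) n = 0" for n
    using Suc.prems(1)[of n] by (simp add: funpow_swap1)
  then have step: "forward_diff f (Suc n) = forward_diff f n" for n
    using Suc.IH[of "forward_diff f" "2 * C"] bd by blast
  have const: "forward_diff f n = forward_diff f 0" for n
    by (induction n) (simp_all add: step)
  have lin: "f n = f 0 + real n * forward_diff f 0" for n
  proof (induction n)
    case (Suc n)
    have "f (Suc n) = f n + forward_diff f 0"
      using const[of n] by (simp add: forward_diff_def)
    then show ?case using Suc by (simp add: algebra_simps)
  qed simp
  have "forward_diff f 0 = 0"
  proof (rule ccontr)
    assume nz: "forward_diff f 0 \<noteq> 0"
    then obtain n where n: "2 * C < real n * \<bar>forward_diff f 0\<bar>"
      using reals_Archimedean3[of "\<bar>forward_diff f 0\<bar>"] by auto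
    have "real n * \<bar>forward_diff f 0\<bar> = \<bar>f n - f 0\<bar>"
      using lin[of n] by (simp add: abs_mult)
    also have "\<dots> \<le> 2 * C" using Suc.prems(2)[of n] Suc.prems(2)[of 0] by linarith
    finally show False using n by linarith
  qed
  then show ?case using const[of n] by (simp add: forward_diff_def)
qed

text \<open>
  If the differences of a sequence stay below \<open>- c < 0\<close>, then the sequence tends to \<open>- \<infinity>\<close> and so
  drops below \<open>- c\<close> itself; this descends through the orders of differencing one at a time.
\<close>

lemma eventually_negative_of_iterated_forward_diff:
  assumes "c > 0" and "\<forall>\<^sub>F n in sequentially. (forward_diff ^^ m) f n \<le> - c"
  shows "\<forall>\<^sub>F n in sequentially. f n \<le> - c"
  using assms(2)
proof (induction m arbitrary: f)
  case (Suc m)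
  define h where "h = (forward_diff ^^ m) f"
  obtain N where N: "h (Suc n) - h n \<le> - c" if "n \<ge> N" for n
  proof -
    have "\<exists>N. \<forall>n\<ge>N. forward_diff h n \<le> - c"
      using Suc.prems by (simp add: eventually_sequentially h_def)
    then show ?thesis using that unfolding forward_diff_def by blast
  qed
  have lin: "h (N + k) \<le> h N - real k * c" for k
  proof (induction k)
    case (Suc k)
    then show ?case using N[of "N + k"] by (simp add: algebra_simps)
  qed simp
  obtain K where K: "h N + c < real K * c"
    using reals_Archimedean3[OF assms(1)] by blast
  have "h n \<le> - c" if "n \<ge> N + K" for n
  proof -
    have "real K * c \<le> real (n - N) * c" using that assms(1) by (intro mult_right_mono) auto
    then show ?thesis using lin[of "n - N"] K that by simp
  qed
  then have "\<forall>\<^sub>F n in sequentially. (forward_diff ^^ m) f n \<le> - c"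
    unfolding h_def eventually_sequentially by blast
  then show ?case by (rule Suc.IH)
qed simp

text \<open>
  Since \<open>n \<mapsto> n choose m\<close> has \<open>m\<close>-th difference \<open>1\<close>, the nonnegative sequence
  \<open>f n - c (n choose m)\<close> has \<open>m\<close>-th difference \<open>- c\<close>, which cannot be negative.
\<close>

lemma polynomial_sequence_growth_bound:
  assumes zero: "\<And>n. (forward_diff ^^ m) f n = 0"
    and lower: "\<And>n. c * real (n choose m) \<le> f n"
  shows "c \<le> 0"
proof (rule ccontr)
  assume "\<not> c \<le> 0"
  then have c: "c > 0" by simp
  define g where "g n = f n - c * real (n choose m)" for n
  have "(forward_diff ^^ m) g n = - c" for n
    unfolding g_def iterated_forward_diff_diff iterated_forward_diff_cmult
    by (simp add: zero iterated_forward_diff_binomial)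
  then have "\<forall>\<^sub>F n in sequentially. g n \<le> - c"
    using eventually_negative_of_iterated_forward_diff[OF c, of m g] by simp
  then obtain n where "g n \<le> - c" by (auto simp: eventually_sequentially)
  then show False using lower[of n] c by (simp add: g_def)
qed

lemma powr_left_cancel:
  fixes a b p :: real
  assumes "a powr p = b powr p" "p > 0" "a \<ge> 0" "b \<ge> 0"
  shows "a = b"
  using assms powr_less_mono2[of p a b] powr_less_mono2[of p b a] by linarith

section \<open>Commuting families of maps\<close>

locale commuting_family =
  fixes I :: "'i set" and T :: "'i \<Rightarrow> 'a \<Rightarrow> 'a"
  assumes finite_index: "finite I"
    and commute: "i \<in> I \<Longrightarrow> j \<in> I \<Longrightarrow> T i (T j x) = T j (T i x)"
begin

lemma commute_funpow: "i \<in> I \<Longrightarrow> j \<in> I \<Longrightarrow> (T i ^^ n) (T j x) = T j ((T i ^^ n) x)"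
  by (induction n) (auto simp: commute)

lemma commute_funpow_funpow:
  "i \<in> I \<Longrightarrow> j \<in> I \<Longrightarrow> (T i ^^ n) ((T j ^^ k) x) = (T j ^^ k) ((T i ^^ n) x)"
  by (induction k) (auto simp: commute_funpow)

text \<open>
  Pulling \<open>P\<close> back along \<open>J\<close> builds a tree whose nodes are images of \<open>y\<close>. By commutativity,
  each step along \<open>i\<close> lowers by one the power of \<open>T i\<close> that is needed to reach \<open>Z\<close>, so every branch enters
  the stable set \<open>Z\<close> after finitely many steps. This stands in for the pigeonhole argument that
  a long multi-index has a large component.
\<close>

lemma backward_induction:
  assumes J: "J \<subseteq> I"
    and step: "\<And>y. (\<And>i. i \<in> J \<Longrightarrow> P (T i y)) \<Longrightarrow> P y"
    and base: "\<And>y. Z y \<Longrightarrow> P y"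
    and stable: "\<And>i y. i \<in> J \<Longrightarrow> Z y \<Longrightarrow> Z (T i y)"
    and reach: "\<And>i. i \<in> J \<Longrightarrow> \<exists>n. Z ((T i ^^ n) y)"
  shows "P y"
proof -
  have fin: "finite J" using J finite_index by (rule finite_subset)
  have "P y" if "\<forall>i\<in>J. Z ((T i ^^ e i) y)" for e y
    using that
  proof (induction "\<Sum>i\<in>J. e i" arbitrary: e y rule: less_induct)
    case less
    show ?case
    proof (cases "\<exists>i\<in>J. e i = 0")
      case True
      then obtain i where "i \<in> J" "e i = 0" by blast
      then have "Z y" using less.prems by fastforce
      then show ?thesis by (rule base)
    next
      case False
      show ?thesis
      proof (rule step)
        fix i assume i: "i \<in> J"
        define e' where "e' = e(i := e i - 1)"
        have "Z ((T j ^^ e' j) (T i y))" if j: "j \<in> J" for j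
        proof (cases "j = i")
          case True
          have "(T i ^^ (e i - 1)) (T i y) = (T i ^^ e i) y"
            using False i by (metis Suc_pred' funpow_Suc_right o_apply neq0_conv)
          then show ?thesis using True less.prems i by (simp add: e'_def)
        next
          case jn: False
          then have "(T j ^^ e' j) (T i y) = T i ((T j ^^ e j) y)"
            using commute_funpow[of j i] i j J by (auto simp: e'_def)
          then show ?thesis using less.prems j i stable by simp
        qed
        moreover have "(\<Sum>j\<in>J. e' j) < (\<Sum>j\<in>J. e j)"
          using fin i False by (intro sum_strict_mono_ex1) (auto simp: e'_def)
        ultimately show "P (T i y)" using less.hyps by blast
      qed
    qed
  qed
  moreover obtain e where "\<forall>i\<in>J. Z ((T i ^^ e i) y)" using reach by metis
  ultimately show ?thesis by blast
qed

text \<open>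
  The \<open>m\<close>-th difference of \<open>q\<close> obeys the same recursion as \<open>q\<close>, so it vanishes at every \<open>n\<close> once
  it vanishes at \<open>0\<close> for all vectors.
\<close>

lemma forward_diff_zero_everywhere:
  assumes rec: "\<And>n x. q (Suc n) x = (\<Sum>i\<in>I. q n (T i x))"
    and zero: "\<And>x. (forward_diff ^^ m) (\<lambda>n. q n x) 0 = 0"
  shows "(forward_diff ^^ m) (\<lambda>n. q n x) n = 0"
proof (induction n arbitrary: x)
  case (Suc n)
  have "(forward_diff ^^ m) (\<lambda>n. q n x) (Suc n) = (forward_diff ^^ m) (\<lambda>n. q (n + 1) x) n"
    by (simp add: iterated_forward_diff_shift[where f = "\<lambda>n. q n x"] del: One_nat_def) simp
  also have "\<dots> = (\<Sum>i\<in>I. (forward_diff ^^ m) (\<lambda>n. q n (T i x)) n)"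
    by (simp add: rec iterated_forward_diff_sum)
  finally show ?case by (simp add: Suc.IH)
qed (rule zero)

end

section \<open>Families that are isometric in both senses\<close>

text \<open>
  The model has \<open>q\<^sub>n(x) = \<Sum>\<^bsub>|\<alpha>| = n\<^esub> n!/\<alpha>! \<parallel>T\<^sup>\<alpha> x\<parallel>\<^sup>p\<close> and
  \<open>A(x) = max\<^bsub>|\<alpha>| \<le> \<mu>\<^esub> \<parallel>T\<^sup>\<alpha> x\<parallel>\<close>. The last property transfers lower bounds on \<open>A\<close> to the
  polynomials \<open>q\<close>: some \<open>\<parallel>T\<^sup>\<alpha> x\<parallel>\<close> with \<open>|\<alpha>| \<le> \<mu>\<close> equals \<open>A(x)\<close>.
\<close>

locale doubly_isometric_family = commuting_family I T
  for I :: "'i set" and T :: "'i \<Rightarrow> 'a::real_normed_vector \<Rightarrow> 'a" +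
  fixes q :: "nat \<Rightarrow> 'a \<Rightarrow> real" and A :: "'a \<Rightarrow> real" and p :: real and m \<mu> :: nat
  assumes p_pos: "p > 0"
    and map_zero: "i \<in> I \<Longrightarrow> T i 0 = 0"
    and q_0: "q 0 x = norm x powr p"
    and q_Suc: "q (Suc n) x = (\<Sum>i\<in>I. q n (T i x))"
    and q_diff: "(forward_diff ^^ m) (\<lambda>n. q n x) n = 0"
    and norm_le_A: "norm x \<le> A x"
    and A_map_le: "i \<in> I \<Longrightarrow> A (T i x) \<le> A x"
    and A_le_map: "\<exists>i\<in>I. A x \<le> A (T i x)"
    and A_le_q: "A x powr p \<le> (\<Sum>k\<le>\<mu>. q k x)"
begin

lemma map_funpow_zero: "i \<in> I \<Longrightarrow> (T i ^^ n) 0 = 0"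
  by (induction n) (auto simp: map_zero)

lemma q_nonneg: "q n x \<ge> 0"
  by (induction n arbitrary: x) (auto simp: q_0 q_Suc intro: sum_nonneg)

lemma A_funpow_le: "i \<in> I \<Longrightarrow> A ((T i ^^ n) x) \<le> A x"
proof (induction n)
  case (Suc n)
  then show ?case using A_map_le[of i "(T i ^^ n) x"] by simp
qed simp

text \<open>
  There are \<open>n choose r\<close> words of length \<open>n\<close> with \<open>r\<close> letters \<open>T i\<close> and \<open>n - r\<close> letters \<open>T j\<close>, and
  each contributes at least \<open>c powr p\<close>. In the induction, splitting off the first letter of a word
  is Pascal's rule.
\<close>

lemma growth_from_two_directions:
  assumes i: "i \<in> I" and j: "j \<in> I" and ij: "i \<noteq> j" and c: "c \<ge> 0"
    and lower: "\<And>n. c \<le> A ((T j ^^ n) ((T i ^^ r) x))"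
  shows "c powr p * real (n choose r) \<le> (\<Sum>k\<le>\<mu>. q (n + k) x)"
  using lower
proof (induction n arbitrary: r x)
  case 0
  show ?case
  proof (cases r)
    case 0
    then have "c powr p \<le> A x powr p" using "0.prems"[of 0] c p_pos by (intro powr_mono2) auto
    then show ?thesis using A_le_q[of x] 0 by simp
  qed (auto intro: sum_nonneg q_nonneg)
next
  case (Suc n)
  define F where "F x = (\<Sum>k\<le>\<mu>. q (n + k) x)" for x
  have F0: "F x \<ge> 0" for x unfolding F_def by (intro sum_nonneg q_nonneg)
  have F: "(\<Sum>k\<le>\<mu>. q (Suc n + k) x) = (\<Sum>l\<in>I. F (T l x))"
    by (simp add: q_Suc F_def sum.swap[of _ I])
  have fj: "c powr p * real (n choose r) \<le> F (T j x)"
    unfolding F_def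
  proof (rule Suc.IH)
    fix k
    have "(T j ^^ k) ((T i ^^ r) (T j x)) = (T j ^^ Suc k) ((T i ^^ r) x)"
      using i j by (simp add: commute_funpow)
    then show "c \<le> A ((T j ^^ k) ((T i ^^ r) (T j x)))" using Suc.prems[of "Suc k"] by simp
  qed
  have two: "F (T j x) + F (T i x) \<le> (\<Sum>l\<in>I. F (T l x))"
  proof -
    have "(\<Sum>l\<in>{j, i}. F (T l x)) \<le> (\<Sum>l\<in>I. F (T l x))"
      using i j finite_index F0 by (intro sum_mono2) auto
    then show ?thesis using ij by simp
  qed
  show ?case
  proof (cases r)
    case 0
    then show ?thesis using fj two F0[of "T i x"] unfolding F by simp
  next
    case (Suc s)
    have "c powr p * real (n choose s) \<le> F (T i x)"
      unfolding F_def
    proof (rule Suc.IH)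
      fix k
      show "c \<le> A ((T j ^^ k) ((T i ^^ s) (T i x)))"
        using Suc.prems[of k] Suc by (simp add: funpow_swap1)
    qed
    then show ?thesis using fj two Suc unfolding F by (simp add: algebra_simps)
  qed
qed

text \<open>
  The invariance of \<open>A\<close> singles out one direction \<open>l\<close> along which a nonzero \<open>y\<close> does not decay;
  if every direction decayed, backward induction would give \<open>A y < A y\<close>. Combined with \<open>m\<close> steps
  in a second direction, this contradicts the degree bound on \<open>q\<close>.
\<close>

lemma powers_annihilate:
  assumes i: "i \<in> I" and j: "j \<in> I" and ij: "i \<noteq> j"
  shows "(T i ^^ m) ((T j ^^ m) x) = 0"
proof (rule ccontr)
  define y where "y = (T i ^^ m) ((T j ^^ m) x)"
  assume "(T i ^^ m) ((T j ^^ m) x) \<noteq> 0"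
  then have c: "A y > 0" using norm_le_A[of y] unfolding y_def by (smt (verit) zero_less_norm_iff)
  have "\<exists>l\<in>I. \<forall>n. A y \<le> A ((T l ^^ n) y)"
  proof (rule ccontr)
    assume neg: "\<not> ?thesis"
    have "A y < A y"
    proof (rule backward_induction[where J = I and P = "\<lambda>z. A z < A y" and Z = "\<lambda>z. A z < A y"])
      show "A z < A y" if "\<And>i. i \<in> I \<Longrightarrow> A (T i z) < A y" for z
        using A_le_map[of z] that by force
      show "\<exists>n. A ((T i ^^ n) y) < A y" if "i \<in> I" for i
        using neg that by (auto simp: not_le)
      show "A (T i z) < A y" if "i \<in> I" "A z < A y" for i z
        using A_map_le[OF that(1), of z] that(2) by linarith
    qed auto
    then show False by simp
  qed
  then obtain l where l: "l \<in> I" and low: "\<And>n. A y \<le> A ((T l ^^ n) y)" by blast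
  \<comment> \<open>Dropping from \<open>y\<close> one of its two powers, that of \<open>T l\<close> if it occurs, does not decrease \<open>A\<close>
    along \<open>T l\<close>; the power that stays belongs to a direction \<open>k \<noteq> l\<close>.\<close>
  obtain k where k: "k \<in> I" "k \<noteq> l" and dom: "\<And>n. A ((T l ^^ n) y) \<le> A ((T l ^^ n) ((T k ^^ m) x))"
  proof (cases "l = i")
    case True
    have "(T l ^^ n) y = (T i ^^ m) ((T l ^^ n) ((T j ^^ m) x))" for n
      unfolding y_def using commute_funpow_funpow l i by blast
    then show ?thesis using that[of j] A_funpow_le i j ij True by simp
  next
    case False
    have "(T l ^^ n) y = (T j ^^ m) ((T l ^^ n) ((T i ^^ m) x))" for n
      unfolding y_def using commute_funpow_funpow l i j by metis
    then show ?thesis using that[of i] A_funpow_le i j False by simp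
  qed
  have "A y powr p * real (n choose m) \<le> (\<Sum>k\<le>\<mu>. q (n + k) x)" for n
  proof (rule growth_from_two_directions[OF k(1) l k(2)])
    show "A y \<le> A ((T l ^^ n) ((T k ^^ m) x))" for n using low dom order_trans by blast
  qed (use c in simp)
  moreover have "(forward_diff ^^ m) (\<lambda>n. \<Sum>k\<le>\<mu>. q (n + k) x) n = 0" for n
    by (simp add: iterated_forward_diff_sum iterated_forward_diff_shift[where f = "\<lambda>n. q n x"] q_diff)
  ultimately have "A y powr p \<le> 0" by (intro polynomial_sequence_growth_bound)
  then show False using c by simp
qed

lemma powers_annihilate_ge:
  assumes "i \<in> I" "j \<in> I" "i \<noteq> j" "n \<ge> m" "k \<ge> m"
  shows "(T i ^^ n) ((T j ^^ k) x) = 0"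
proof -
  have "(T i ^^ n) ((T j ^^ k) x) = (T i ^^ (n - m)) ((T i ^^ m) ((T j ^^ m) ((T j ^^ (k - m)) x)))"
    using assms by (metis comp_apply funpow_add le_add_diff_inverse le_add_diff_inverse2)
  then show ?thesis using assms powers_annihilate map_funpow_zero by simp
qed

lemma q_zero: "q n 0 = 0"
  by (induction n) (auto simp: q_0 q_Suc map_zero)

text \<open>
  Let \<open>D\<^sub>n(k)\<close> be the increment of \<open>k \<mapsto> q\<^sub>n(T\<^sub>j\<^sup>k y)\<close>. The assumption removes the directions other
  than \<open>j\<close> from the recursion, leaving \<open>D\<^bsub>n+1\<^esub>(k) = D\<^sub>n(k+1)\<close>. Hence the increments of
  \<open>g(k) = \<parallel>T\<^sub>j\<^sup>k y\<parallel>\<^sup>p\<close> are the numbers \<open>D\<^sub>n(0)\<close>, which are polynomial in \<open>n\<close>; so \<open>g\<close> is a bounded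
  polynomial and all increments vanish.
\<close>

lemma q_invariant_step:
  assumes j: "j \<in> I" and inv: "\<And>i k n. i \<in> I - {j} \<Longrightarrow> q n ((T j ^^ k) (T i y)) = q n (T i y)"
  shows "q n ((T j ^^ k) y) = q n y"
proof -
  define D where "D n k = q n ((T j ^^ Suc k) y) - q n ((T j ^^ k) y)" for n k
  define g where "g k = norm ((T j ^^ k) y) powr p" for k
  have shift: "D (Suc n) k = D n (Suc k)" for n k
  proof -
    have com: "T i ((T j ^^ k) y) = (T j ^^ k) (T i y)" if "i \<in> I" for i k
      using that j by (simp add: commute_funpow)
    have "D (Suc n) k = (\<Sum>i\<in>I. q n ((T j ^^ Suc k) (T i y)) - q n ((T j ^^ k) (T i y)))"
      unfolding D_def q_Suc sum_subtractf[symmetric]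
      by (intro sum.cong refl) (simp add: com del: funpow.simps)
    also have "\<dots> = q n ((T j ^^ Suc k) (T j y)) - q n ((T j ^^ k) (T j y))"
      by (subst sum.remove[OF finite_index j]) (simp add: inv del: funpow.simps)
    also have "\<dots> = D n (Suc k)"
      by (simp add: D_def funpow_swap1)
    finally show ?thesis .
  qed
  have D: "D n k = forward_diff g (n + k)" for n k
    by (induction n arbitrary: k) (simp_all add: shift, simp add: D_def g_def q_0 forward_diff_def)
  have "(forward_diff ^^ Suc m) g n = 0" for n
  proof -
    have "forward_diff g = (\<lambda>n. q n (T j y) - q n y)"
      using D[of _ 0] by (auto simp: D_def)
    then show ?thesis
      by (simp only: funpow_Suc_right o_apply) (simp add: iterated_forward_diff_diff q_diff)
  qed
  moreover have "\<bar>g k\<bar> \<le> A y powr p" for k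
    unfolding g_def using norm_le_A[of "(T j ^^ k) y"] A_funpow_le[OF j, of k y] p_pos
    by (simp add: powr_mono2)
  ultimately have "g (Suc k) = g k" for k
    by (rule bounded_polynomial_sequence_constant)
  then have "forward_diff g k = 0" for k by (simp add: forward_diff_def)
  then have "q n ((T j ^^ Suc k) y) = q n ((T j ^^ k) y)" for k
    using D[of n k] by (simp add: D_def)
  then show ?thesis by (induction k) auto
qed

lemma q_invariant:
  assumes j: "j \<in> I"
  shows "q n ((T j ^^ k) ((T j ^^ m) x)) = q n ((T j ^^ m) x)"
proof -
  have "\<forall>k n. q n ((T j ^^ k) ((T j ^^ m) x)) = q n ((T j ^^ m) x)"
  proof (rule backward_induction[where J = "I - {j}" and Z = "\<lambda>y. y = 0"
        and P = "\<lambda>y. \<forall>k n. q n ((T j ^^ k) y) = q n y"])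
    show "\<forall>k n. q n ((T j ^^ k) y) = q n y"
      if "\<And>i. i \<in> I - {j} \<Longrightarrow> \<forall>k n. q n ((T j ^^ k) (T i y)) = q n (T i y)" for y
      using q_invariant_step[OF j] that by blast
    show "\<exists>n. (T i ^^ n) ((T j ^^ m) x) = 0" if "i \<in> I - {j}" for i
      using powers_annihilate that j by blast
  qed (use j in \<open>auto simp: map_funpow_zero map_zero\<close>)
  then show ?thesis by blast
qed

theorem norm_power_eventually_constant:
  assumes "j \<in> I" "n \<ge> m"
  shows "norm ((T j ^^ n) x) = norm ((T j ^^ m) x)"
proof -
  have "norm ((T j ^^ n) x) powr p = norm ((T j ^^ m) x) powr p"
    using q_invariant[OF assms(1), of 0 "n - m" x] assms(2)
    by (simp add: q_0 flip: funpow_add[THEN fun_cong, unfolded o_apply])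
  then show ?thesis using p_pos by (auto dest: powr_left_cancel)
qed

text \<open>
  The defect \<open>E\<^sub>n(x)\<close> between the two sides satisfies the same recursion and difference equation
  as \<open>q\<close>. If it vanishes at every \<open>T\<^sub>i x\<close>, the recursion gives \<open>E\<^sub>n(x) = 0\<close> for \<open>n \<ge> 1\<close>, and
  polynomiality gives \<open>E\<^sub>0(x) = 0\<close> as well.
\<close>

theorem q_decomposition: "(\<Sum>j\<in>I. q n ((T j ^^ m) x)) = q n x"
proof -
  define E where "E n x = q n x - (\<Sum>j\<in>I. q n ((T j ^^ m) x))" for n x
  have E_Suc: "E (Suc n) x = (\<Sum>i\<in>I. E n (T i x))" for n x
  proof -
    have "(\<Sum>j\<in>I. \<Sum>i\<in>I. q n (T i ((T j ^^ m) x))) = (\<Sum>j\<in>I. \<Sum>i\<in>I. q n ((T j ^^ m) (T i x)))"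
      by (intro sum.cong refl) (simp add: commute_funpow)
    also have "\<dots> = (\<Sum>i\<in>I. \<Sum>j\<in>I. q n ((T j ^^ m) (T i x)))" by (rule sum.swap)
    finally show ?thesis by (simp add: E_def q_Suc sum_subtractf)
  qed
  have E_diff: "(forward_diff ^^ m) (\<lambda>n. E n x) n = 0" for n x
    unfolding E_def iterated_forward_diff_diff iterated_forward_diff_sum by (simp add: q_diff)
  have "\<forall>n. E n x = 0"
  proof (rule backward_induction[where J = I and Z = "\<lambda>y. \<exists>j\<in>I. \<exists>z. y = (T j ^^ m) z"
        and P = "\<lambda>y. \<forall>n. E n y = 0"])
    fix y assume "\<And>i. i \<in> I \<Longrightarrow> \<forall>n. E n (T i y) = 0"
    then have pos: "E (Suc n) y = 0" for n by (simp add: E_Suc)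
    \<comment> \<open>A sequence that vanishes from \<open>1\<close> on is bounded, hence constant if polynomial.\<close>
    have "\<bar>E n y\<bar> \<le> \<bar>E 0 y\<bar>" for n by (cases n) (simp_all add: pos)
    then have "E (Suc 0) y = E 0 y"
      by (rule bounded_polynomial_sequence_constant[where f = "\<lambda>n. E n y", OF E_diff])
    then show "\<forall>n. E n y = 0" using pos by (metis not0_implies_Suc)
  next
    fix y assume "\<exists>j\<in>I. \<exists>z. y = (T j ^^ m) z"
    then obtain j z where j: "j \<in> I" and y: "y = (T j ^^ m) z" by blast
    have "(\<Sum>i\<in>I. q n ((T i ^^ m) y)) = q n y" for n
    proof (subst sum.remove[OF finite_index j])
      have "(\<Sum>i\<in>I - {j}. q n ((T i ^^ m) y)) = 0"
        using j powers_annihilate by (intro sum.neutral) (auto simp: y q_zero)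
      then show "q n ((T j ^^ m) y) + (\<Sum>i\<in>I - {j}. q n ((T i ^^ m) y)) = q n y"
        using q_invariant[OF j] by (simp add: y)
    qed
    then show "\<forall>n. E n y = 0" by (simp add: E_def)
  next
    fix i y assume "i \<in> I" "\<exists>j\<in>I. \<exists>z. y = (T j ^^ m) z"
    then show "\<exists>j\<in>I. \<exists>z. T i y = (T j ^^ m) z" by (metis commute_funpow)
  qed auto
  then show ?thesis by (simp add: E_def)
qed

corollary sum_norm_powers: "(\<Sum>j\<in>I. norm ((T j ^^ m) x) powr p) = norm x powr p"
  using q_decomposition[of 0 x] by (simp add: q_0)

theorem norm_sum_powers:
  assumes add: "\<And>i x y. i \<in> I \<Longrightarrow> T i (x + y) = T i x + T i y"
    and n: "\<And>j. j \<in> I \<Longrightarrow> n j \<ge> m"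
  shows "norm (\<Sum>j\<in>I. (T j ^^ n j) x) = norm x"
proof -
  define y where "y = (\<Sum>j\<in>I. (T j ^^ n j) x)"
  have add_pow: "(T i ^^ k) (x + z) = (T i ^^ k) x + (T i ^^ k) z" if "i \<in> I" for i k x z
    using that by (induction k) (simp_all add: add)
  have sum_pow: "(T i ^^ k) (\<Sum>j\<in>J. f j) = (\<Sum>j\<in>J. (T i ^^ k) (f j))"
    if "i \<in> I" for i k f and J :: "'i set"
    by (induction J rule: infinite_finite_induct) (simp_all add: that add_pow map_funpow_zero)
  have "norm ((T i ^^ m) y) = norm ((T i ^^ m) x)" if i: "i \<in> I" for i
  proof -
    have "(T i ^^ m) y = (\<Sum>j\<in>I. (T i ^^ m) ((T j ^^ n j) x))"
      unfolding y_def by (rule sum_pow[OF i])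
    also have "\<dots> = (T i ^^ m) ((T i ^^ n i) x)"
    proof -
      have "(\<Sum>j\<in>I - {i}. (T i ^^ m) ((T j ^^ n j) x)) = 0"
        using i n powers_annihilate_ge[OF i _ _ order_refl] by (intro sum.neutral) blast
      then show ?thesis by (subst sum.remove[OF finite_index i]) simp
    qed
    also have "\<dots> = (T i ^^ (m + n i)) x" by (simp add: funpow_add)
    finally show ?thesis using norm_power_eventually_constant[OF i, of "m + n i" x] by simp
  qed
  then have "(\<Sum>i\<in>I. norm ((T i ^^ m) y) powr p) = (\<Sum>i\<in>I. norm ((T i ^^ m) x) powr p)"
    by (intro sum.cong refl) simp
  then have "norm y powr p = norm x powr p" by (simp only: sum_norm_powers)
  then show ?thesis using p_pos unfolding y_def by (auto dest: powr_left_cancel)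
qed

end

section \<open>Multi-indices\<close>

lemma finite_multi_indices: "finite {\<alpha> \<in> multi_indices d. mi_abs d \<alpha> \<le> n}"
proof (rule finite_subset)
  have le: "\<alpha> j \<le> mi_abs d \<alpha>" if "j \<in> {1..d}" for \<alpha> j
    unfolding mi_abs_def using that by (intro member_le_sum) auto
  show "{\<alpha> \<in> multi_indices d. mi_abs d \<alpha> \<le> n} \<subseteq> {1..d} \<rightarrow>\<^sub>E {..n}"
    by (intro subsetI) (auto simp: multi_indices_def PiE_iff intro: order_trans[OF le])
qed (simp add: finite_PiE)

lemma finite_multi_indices_eq: "finite {\<alpha> \<in> multi_indices d. mi_abs d \<alpha> = n}"
  by (rule finite_subset[OF _ finite_multi_indices[of d n]]) auto

lemma multi_index_upd: "\<alpha> \<in> multi_indices d \<Longrightarrow> j \<in> {1..d} \<Longrightarrow> \<alpha>(j := k) \<in> multi_indices d"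
  by (auto simp: multi_indices_def PiE_iff extensional_def)

lemma mi_abs_upd_Suc: "j \<in> {1..d} \<Longrightarrow> mi_abs d (\<alpha>(j := Suc (\<alpha> j))) = Suc (mi_abs d \<alpha>)"
  unfolding mi_abs_def by (subst (1 2) sum.remove[where x = j]) auto

lemma mi_fact_upd_Suc:
  "j \<in> {1..d} \<Longrightarrow> mi_fact d (\<alpha>(j := Suc (\<alpha> j))) = real (Suc (\<alpha> j)) * mi_fact d \<alpha>"
  unfolding mi_fact_def by (subst (1 2) prod.remove[where x = j]) (auto simp: algebra_simps)

lemma multi_index_decompose:
  assumes "\<beta> \<in> multi_indices d" and j: "j \<in> {1..d}" and "\<beta> j \<noteq> 0"
  obtains \<alpha> where "\<alpha> \<in> multi_indices d" "\<beta> = \<alpha>(j := Suc (\<alpha> j))" "mi_abs d \<beta> = Suc (mi_abs d \<alpha>)"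
proof -
  have "\<beta> = (\<beta>(j := \<beta> j - 1))(j := Suc ((\<beta>(j := \<beta> j - 1)) j))" using assms(3) by auto
  then show ?thesis
    using that[of "\<beta>(j := \<beta> j - 1)"] multi_index_upd[OF assms(1) j] mi_abs_upd_Suc[OF j] by metis
qed

lemma multi_index_nonzero_component:
  assumes "mi_abs d \<beta> \<noteq> 0" obtains j where "j \<in> {1..d}" "\<beta> j \<noteq> 0"
  using assms unfolding mi_abs_def by (meson sum.neutral)

lemma multi_indices_abs_0:
  "{\<alpha> \<in> multi_indices d. mi_abs d \<alpha> = 0} = {restrict (\<lambda>_. 0) {1..d}}"
  by (auto simp: multi_indices_def mi_abs_def PiE_iff extensional_def fun_eq_iff)

text \<open>
  This is the identity \<open>(n+1)!/\<beta>! = \<Sum>\<^sub>j n! \<beta>\<^sub>j/\<beta>!\<close>, which uses \<open>\<Sum>\<^sub>j \<beta>\<^sub>j = n + 1\<close>. The \<open>j\<close>-th summand is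
  the multinomial coefficient of \<open>\<beta> - e\<^sub>j\<close> if \<open>\<beta>\<^sub>j > 0\<close>, and zero otherwise.
\<close>

lemma multinomial_recursion:
  "(\<Sum>\<beta>\<in>{\<beta> \<in> multi_indices d. mi_abs d \<beta> = Suc n}. fact (Suc n) / mi_fact d \<beta> * h \<beta>)
   = (\<Sum>j=1..d. \<Sum>\<alpha>\<in>{\<alpha> \<in> multi_indices d. mi_abs d \<alpha> = n}.
        fact n / mi_fact d \<alpha> * h (\<alpha>(j := Suc (\<alpha> j))))"
    (is "?L = ?R")
proof -
  define M where "M k = {\<alpha> \<in> multi_indices d. mi_abs d \<alpha> = k}" for k
  have fin: "finite (M k)" for k unfolding M_def by (rule finite_multi_indices_eq)
  have per_direction: "(\<Sum>\<alpha>\<in>M n. fact n / mi_fact d \<alpha> * h (\<alpha>(j := Suc (\<alpha> j))))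
      = (\<Sum>\<beta>\<in>M (Suc n). fact n * real (\<beta> j) / mi_fact d \<beta> * h \<beta>)" if j: "j \<in> {1..d}" for j
  proof -
    let ?s = "\<lambda>\<alpha>::nat \<Rightarrow> nat. \<alpha>(j := Suc (\<alpha> j))"
    have inj: "inj_on ?s (M n)"
    proof (rule inj_onI)
      fix \<alpha> \<beta> assume "?s \<alpha> = ?s \<beta>"
      then have "?s \<alpha> i = ?s \<beta> i" for i by simp
      then have "\<alpha> i = \<beta> i" for i by (metis fun_upd_apply nat.inject)
      then show "\<alpha> = \<beta>" by blast
    qed
    have sub: "?s ` M n \<subseteq> M (Suc n)"
      using j by (auto simp: M_def mi_abs_upd_Suc multi_index_upd)
    have rest: "\<beta> j = 0" if \<beta>: "\<beta> \<in> M (Suc n) - ?s ` M n" for \<beta>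
    proof (rule ccontr)
      assume "\<beta> j \<noteq> 0"
      then obtain \<alpha> where "\<alpha> \<in> multi_indices d" "\<beta> = ?s \<alpha>" "mi_abs d \<beta> = Suc (mi_abs d \<alpha>)"
        using multi_index_decompose[OF _ j] \<beta> by (auto simp: M_def)
      then show False using \<beta> by (auto simp: M_def)
    qed
    have "(\<Sum>\<beta>\<in>M (Suc n). fact n * real (\<beta> j) / mi_fact d \<beta> * h \<beta>)
        = (\<Sum>\<beta>\<in>?s ` M n. fact n * real (\<beta> j) / mi_fact d \<beta> * h \<beta>)"
      using fin sub rest by (intro sum.mono_neutral_right) auto
    also have "\<dots> = (\<Sum>\<alpha>\<in>M n. fact n / mi_fact d \<alpha> * h (?s \<alpha>))"
      unfolding sum.reindex[OF inj] using j
      by (intro sum.cong refl) (simp add: mi_fact_upd_Suc del: of_nat_Suc)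
    finally show ?thesis by simp
  qed
  have "?R = (\<Sum>j=1..d. \<Sum>\<beta>\<in>M (Suc n). fact n * real (\<beta> j) / mi_fact d \<beta> * h \<beta>)"
    unfolding M_def[symmetric] by (intro sum.cong refl per_direction)
  also have "\<dots> = (\<Sum>\<beta>\<in>M (Suc n). \<Sum>j=1..d. fact n * real (\<beta> j) / mi_fact d \<beta> * h \<beta>)"
    by (rule sum.swap)
  also have "\<dots> = (\<Sum>\<beta>\<in>M (Suc n). fact (Suc n) / mi_fact d \<beta> * h \<beta>)"
  proof (intro sum.cong refl)
    fix \<beta> assume "\<beta> \<in> M (Suc n)"
    then have "(\<Sum>j=1..d. real (\<beta> j)) = real (Suc n)"
      by (simp add: M_def mi_abs_def flip: of_nat_sum)
    then have "fact (Suc n) / mi_fact d \<beta> * h \<beta>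
        = fact n * (\<Sum>j=1..d. real (\<beta> j)) / mi_fact d \<beta> * h \<beta>"
      by (simp add: algebra_simps)
    then show "(\<Sum>j=1..d. fact n * real (\<beta> j) / mi_fact d \<beta> * h \<beta>)
        = fact (Suc n) / mi_fact d \<beta> * h \<beta>"
      by (simp only: sum_distrib_left sum_distrib_right sum_divide_distrib)
  qed
  finally show ?thesis by (simp add: M_def)
qed

section \<open>Powers of a commuting tuple\<close>

lemma commuting_tuple_family: "commuting_tuple d T \<Longrightarrow> commuting_family {1..d} T"
  by unfold_locales (auto simp: commuting_tuple_def fun_eq_iff)

context commuting_family
begin

lemma commute_foldr_funpow:
  assumes "set js \<subseteq> I" "i \<in> I"
  shows "foldr (\<lambda>j S. (T j ^^ \<alpha> j) \<circ> S) js id (T i x) = T i (foldr (\<lambda>j S. (T j ^^ \<alpha> j) \<circ> S) js id x)"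
  using assms by (induction js) (auto simp: commute_funpow)

text \<open>
  The extra factor \<open>T i\<close> appears in the middle of the product and is moved to the right end by
  commutativity.
\<close>

lemma foldr_funpow_upd_Suc:
  assumes "set js \<subseteq> I" "distinct js" "i \<in> set js"
  shows "foldr (\<lambda>j S. (T j ^^ (\<alpha>(i := Suc (\<alpha> i))) j) \<circ> S) js id x
    = foldr (\<lambda>j S. (T j ^^ \<alpha> j) \<circ> S) js id (T i x)"
  using assms
proof (induction js)
  case (Cons j js)
  show ?case
  proof (cases "i = j")
    case True
    have "foldr (\<lambda>k S. (T k ^^ (\<alpha>(i := Suc (\<alpha> i))) k) \<circ> S) js id
        = foldr (\<lambda>k S. (T k ^^ \<alpha> k) \<circ> S) js id"
      using Cons.prems True by (intro foldr_cong) auto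
    then have "foldr (\<lambda>k S. (T k ^^ (\<alpha>(i := Suc (\<alpha> i))) k) \<circ> S) (j # js) id x
        = (T j ^^ Suc (\<alpha> j)) (foldr (\<lambda>k S. (T k ^^ \<alpha> k) \<circ> S) js id x)"
      using True by (simp only: foldr.simps o_apply fun_upd_same)
    also have "\<dots> = (T j ^^ \<alpha> j) (foldr (\<lambda>k S. (T k ^^ \<alpha> k) \<circ> S) js id (T j x))"
      using Cons.prems by (simp only: funpow_Suc_right o_apply commute_foldr_funpow list.set insert_subset)
    finally show ?thesis unfolding True foldr.simps o_apply .
  next
    case False
    then show ?thesis using Cons by simp
  qed
qed simp

end

lemma tuple_power_upd_Suc:
  assumes "commuting_tuple d T" "j \<in> {1..d}"
  shows "tuple_power d T (\<alpha>(j := Suc (\<alpha> j))) x = tuple_power d T \<alpha> (T j x)"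
proof -
  interpret commuting_family "{1..d}" T using assms(1) by (rule commuting_tuple_family)
  show ?thesis unfolding tuple_power_def using assms(2) by (intro foldr_funpow_upd_Suc) auto
qed

lemma tuple_power_abs_0:
  assumes "mi_abs d \<alpha> = 0" shows "tuple_power d T \<alpha> x = x"
proof -
  have "foldr (\<lambda>j S. (T j ^^ \<alpha> j) \<circ> S) js id x = x" if "\<forall>j\<in>set js. \<alpha> j = 0" for js
    using that by (induction js) auto
  moreover have "\<forall>j\<in>set [1..<Suc d]. \<alpha> j = 0" using assms by (auto simp: mi_abs_def)
  ultimately show ?thesis unfolding tuple_power_def by blast
qed

definition power_sum :: "nat \<Rightarrow> real \<Rightarrow> (nat \<Rightarrow> 'a \<Rightarrow> 'a::real_normed_vector) \<Rightarrow> nat \<Rightarrow> 'a \<Rightarrow> real" where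
  "power_sum d p T k x = (\<Sum>\<alpha>\<in>{\<alpha> \<in> multi_indices d. mi_abs d \<alpha> = k}.
     fact k / mi_fact d \<alpha> * norm (tuple_power d T \<alpha> x) powr p)"

lemma power_sum_0: "power_sum d p T 0 x = norm x powr p"
proof -
  let ?z = "restrict (\<lambda>_. 0::nat) {1..d}"
  have "mi_abs d ?z = 0" "mi_fact d ?z = 1" by (simp_all add: mi_abs_def mi_fact_def)
  then show ?thesis by (simp add: power_sum_def multi_indices_abs_0 tuple_power_abs_0)
qed

lemma power_sum_Suc:
  assumes "commuting_tuple d T"
  shows "power_sum d p T (Suc n) x = (\<Sum>j=1..d. power_sum d p T n (T j x))"
  unfolding power_sum_def multinomial_recursion
  by (intro sum.cong refl) (simp add: tuple_power_upd_Suc[OF assms])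

lemma power_sum_nonneg: "power_sum d p T n x \<ge> 0"
  unfolding power_sum_def mi_fact_def by (intro sum_nonneg mult_nonneg_nonneg divide_nonneg_nonneg prod_nonneg) auto

text \<open>
  Multinomial coefficients are at least one; the recursion gives this without computing them.
\<close>

lemma norm_tuple_power_le_power_sum:
  assumes "commuting_tuple d T" "\<alpha> \<in> multi_indices d" "mi_abs d \<alpha> = k"
  shows "norm (tuple_power d T \<alpha> x) powr p \<le> power_sum d p T k x"
  using assms(2,3)
proof (induction k arbitrary: \<alpha> x)
  case 0
  then show ?case by (simp add: power_sum_0 tuple_power_abs_0)
next
  case (Suc k)
  then obtain j where j: "j \<in> {1..d}" "\<alpha> j \<noteq> 0"
    using multi_index_nonzero_component[of d \<alpha>] by auto
  obtain \<beta> where \<beta>: "\<beta> \<in> multi_indices d" "\<alpha> = \<beta>(j := Suc (\<beta> j))" "mi_abs d \<alpha> = Suc (mi_abs d \<beta>)"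
    using multi_index_decompose[OF Suc.prems(1) j] by metis
  have "norm (tuple_power d T \<alpha> x) powr p \<le> power_sum d p T k (T j x)"
    using Suc.IH[OF \<beta>(1)] \<beta>(3) Suc.prems(2) unfolding \<beta>(2) tuple_power_upd_Suc[OF assms(1) j(1)] by simp
  also have "\<dots> \<le> power_sum d p T (Suc k) x"
    unfolding power_sum_Suc[OF assms(1)] using j(1) power_sum_nonneg by (intro member_le_sum) auto
  finally show ?case .
qed

definition orbit_max :: "nat \<Rightarrow> nat \<Rightarrow> (nat \<Rightarrow> 'a \<Rightarrow> 'a::real_normed_vector) \<Rightarrow> 'a \<Rightarrow> real" where
  "orbit_max d \<mu> T x
     = Max ((\<lambda>\<alpha>. norm (tuple_power d T \<alpha> x)) ` {\<alpha> \<in> multi_indices d. mi_abs d \<alpha> \<le> \<mu>})"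

lemma zero_multi_index: "restrict (\<lambda>_. 0) {1..d} \<in> multi_indices d" "mi_abs d (restrict (\<lambda>_. 0) {1..d}) = 0"
  by (auto simp: multi_indices_def mi_abs_def)

lemma norm_tuple_power_le_orbit_max:
  "\<alpha> \<in> multi_indices d \<Longrightarrow> mi_abs d \<alpha> \<le> \<mu> \<Longrightarrow> norm (tuple_power d T \<alpha> x) \<le> orbit_max d \<mu> T x"
  unfolding orbit_max_def using finite_multi_indices by (intro Max_ge) auto

lemma orbit_max_attained:
  obtains \<alpha> where "\<alpha> \<in> multi_indices d" "mi_abs d \<alpha> \<le> \<mu>"
    "orbit_max d \<mu> T x = norm (tuple_power d T \<alpha> x)"
proof -
  have "orbit_max d \<mu> T x \<in> (\<lambda>\<alpha>. norm (tuple_power d T \<alpha> x)) ` {\<alpha> \<in> multi_indices d. mi_abs d \<alpha> \<le> \<mu>}"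
    unfolding orbit_max_def using finite_multi_indices zero_multi_index[of d] by (intro Max_in) fastforce+
  then show ?thesis using that by blast
qed

text \<open>
  The even and the odd maximum agree, so both equal the maximum over all multi-indices.
\<close>

lemma orbit_max_attained_parity:
  assumes iso: "infty_isometric_tuple scale d \<mu> T" and "d \<ge> 1" "\<mu> \<ge> 1"
  obtains \<alpha> where "\<alpha> \<in> multi_indices d" "mi_abs d \<alpha> \<le> \<mu>" "even (mi_abs d \<alpha>) = b"
    "orbit_max d \<mu> T x = norm (tuple_power d T \<alpha> x)"
proof -
  \<comment> \<open>The unit multi-index \<open>e\<^sub>1\<close>, available because \<open>d \<ge> 1\<close> and \<open>\<mu> \<ge> 1\<close>, makes the odd set nonempty;
    the maximum of an empty set would be unspecified.\<close>
  define M where "M b = {\<alpha> \<in> multi_indices d. mi_abs d \<alpha> \<le> \<mu> \<and> even (mi_abs d \<alpha>) = b}" for b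
  let ?f = "\<lambda>\<alpha>. norm (tuple_power d T \<alpha> x)"
  have fin: "finite (M b)" for b
    by (rule finite_subset[OF _ finite_multi_indices[of d \<mu>]]) (auto simp: M_def)
  let ?z = "restrict (\<lambda>_. 0::nat) {1..d}"
  have z: "?z \<in> M True" using zero_multi_index by (simp add: M_def)
  have "?z(1 := Suc (?z 1)) \<in> M False"
    using mi_abs_upd_Suc[of 1 d ?z] multi_index_upd[OF zero_multi_index(1)[of d], of 1] zero_multi_index(2)[of d] assms
    by (simp add: M_def)
  then have ne: "M b \<noteq> {}" for b using z by (cases b) auto
  have eq: "Max (?f ` M b) = Max (?f ` M c)" for b c
    using iso unfolding infty_isometric_tuple_def M_def by (cases b; cases c) simp_all
  obtain \<beta> where \<beta>: "\<beta> \<in> multi_indices d" "mi_abs d \<beta> \<le> \<mu>" "orbit_max d \<mu> T x = ?f \<beta>"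
    by (rule orbit_max_attained)
  have "Max (?f ` M b) \<in> ?f ` M b" using fin ne by (intro Max_in) auto
  then obtain \<alpha> where \<alpha>: "\<alpha> \<in> M b" "Max (?f ` M b) = ?f \<alpha>" by blast
  have "?f \<beta> \<le> Max (?f ` M (even (mi_abs d \<beta>)))" using \<beta> fin by (intro Max_ge) (auto simp: M_def)
  then have "orbit_max d \<mu> T x \<le> ?f \<alpha>" using eq \<alpha>(2) \<beta>(3) by metis
  moreover have "?f \<alpha> \<le> orbit_max d \<mu> T x"
    using \<alpha>(1) by (intro norm_tuple_power_le_orbit_max) (auto simp: M_def)
  ultimately have "orbit_max d \<mu> T x = ?f \<alpha>" by (rule antisym)
  then show ?thesis using that[of \<alpha>] \<alpha>(1) by (simp add: M_def)
qed

text \<open>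
  A maximizing \<open>\<alpha>\<close> for \<open>T j x\<close> can be chosen with the parity opposite to that of \<open>\<mu>\<close>. Then
  \<open>|\<alpha>| < \<mu>\<close>, which leaves room for the extra factor \<open>T j\<close>.
\<close>

lemma orbit_max_map_le:
  assumes "infty_isometric_tuple scale d \<mu> T" "d \<ge> 1" "\<mu> \<ge> 1" and j: "j \<in> {1..d}"
  shows "orbit_max d \<mu> T (T j x) \<le> orbit_max d \<mu> T x"
proof -
  have com: "commuting_tuple d T" using assms(1) by (simp add: infty_isometric_tuple_def)
  obtain \<alpha> where \<alpha>: "\<alpha> \<in> multi_indices d" "mi_abs d \<alpha> \<le> \<mu>" "even (mi_abs d \<alpha>) = odd \<mu>"
    "orbit_max d \<mu> T (T j x) = norm (tuple_power d T \<alpha> (T j x))"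
    using orbit_max_attained_parity[OF assms(1-3), where b = "odd \<mu>"] by metis
  have "mi_abs d \<alpha> \<noteq> \<mu>" using \<alpha>(3) by auto
  then have "mi_abs d (\<alpha>(j := Suc (\<alpha> j))) \<le> \<mu>" using \<alpha>(2) mi_abs_upd_Suc[OF j, of \<alpha>] by simp
  then have "norm (tuple_power d T (\<alpha>(j := Suc (\<alpha> j))) x) \<le> orbit_max d \<mu> T x"
    by (rule norm_tuple_power_le_orbit_max[OF multi_index_upd[OF \<alpha>(1) j]])
  then show ?thesis unfolding \<alpha>(4) tuple_power_upd_Suc[OF com j] .
qed

text \<open>
  An odd maximizing multi-index is nonzero, so a factor \<open>T j\<close> can be split off.
\<close>

lemma orbit_max_le_map:
  assumes "infty_isometric_tuple scale d \<mu> T" "d \<ge> 1" "\<mu> \<ge> 1"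
  shows "\<exists>j\<in>{1..d}. orbit_max d \<mu> T x \<le> orbit_max d \<mu> T (T j x)"
proof -
  have com: "commuting_tuple d T" using assms(1) by (simp add: infty_isometric_tuple_def)
  obtain \<beta> where \<beta>: "\<beta> \<in> multi_indices d" "mi_abs d \<beta> \<le> \<mu>" "even (mi_abs d \<beta>) = False"
    "orbit_max d \<mu> T x = norm (tuple_power d T \<beta> x)"
    using orbit_max_attained_parity[OF assms, where b = False] by metis
  then obtain j where j: "j \<in> {1..d}" "\<beta> j \<noteq> 0"
    using multi_index_nonzero_component[of d \<beta>] by (metis even_zero)
  obtain \<alpha> where \<alpha>: "\<alpha> \<in> multi_indices d" "\<beta> = \<alpha>(j := Suc (\<alpha> j))" "mi_abs d \<beta> = Suc (mi_abs d \<alpha>)"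
    using multi_index_decompose[OF \<beta>(1) j] by metis
  have "orbit_max d \<mu> T x = norm (tuple_power d T \<alpha> (T j x))"
    unfolding \<beta>(4) \<alpha>(2) tuple_power_upd_Suc[OF com j(1)] ..
  also have "\<dots> \<le> orbit_max d \<mu> T (T j x)"
    using \<alpha> \<beta>(2) by (intro norm_tuple_power_le_orbit_max) auto
  finally show ?thesis using j(1) by blast
qed

lemma mp_isometric_tuple_iff:
  "mp_isometric_tuple scale d m p T \<longleftrightarrow>
     (\<forall>j\<in>{1..d}. Vector_Spaces.linear scale scale (T j)) \<and> commuting_tuple d T \<and>
     (\<forall>x. (forward_diff ^^ m) (\<lambda>n. power_sum d p T n x) 0 = 0)"
  unfolding mp_isometric_tuple_def iterated_forward_diff power_sum_def by simp

lemma doubly_isometric_family_of_tuple: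
  assumes "p > 0" "d \<ge> 1" "\<mu> \<ge> 1"
    and mp: "mp_isometric_tuple scale d m p T" and inf: "infty_isometric_tuple scale d \<mu> T"
  shows "doubly_isometric_family {1..d} T (power_sum d p T) (orbit_max d \<mu> T) p m \<mu>"
proof -
  have com: "commuting_tuple d T" using mp by (simp add: mp_isometric_tuple_def)
  interpret commuting_family "{1..d}" T using com by (rule commuting_tuple_family)
  have lin: "Vector_Spaces.linear scale scale (T j)" if "j \<in> {1..d}" for j
    using mp that by (simp add: mp_isometric_tuple_def)
  show ?thesis
  proof unfold_locales
    show "T i 0 = 0" if "i \<in> {1..d}" for i
      using lin[OF that] by (rule module_hom.zero[OF Vector_Spaces.module_hom_linearI])
    show "power_sum d p T (Suc n) x = (\<Sum>i=1..d. power_sum d p T n (T i x))" for n x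
      by (rule power_sum_Suc[OF com])
    show "(forward_diff ^^ m) (\<lambda>n. power_sum d p T n x) n = 0" for n x
    proof (rule forward_diff_zero_everywhere[where q = "power_sum d p T"])
      show "(forward_diff ^^ m) (\<lambda>n. power_sum d p T n x) 0 = 0" for x
        using mp by (simp add: mp_isometric_tuple_iff)
    qed (rule power_sum_Suc[OF com])
    show "norm x \<le> orbit_max d \<mu> T x" for x
      using norm_tuple_power_le_orbit_max[OF zero_multi_index(1)] tuple_power_abs_0[OF zero_multi_index(2)]
        zero_multi_index(2) by (metis zero_le)
    show "orbit_max d \<mu> T x powr p \<le> (\<Sum>k\<le>\<mu>. power_sum d p T k x)" for x
    proof -
      obtain \<alpha> where \<alpha>: "\<alpha> \<in> multi_indices d" "mi_abs d \<alpha> \<le> \<mu>"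
        "orbit_max d \<mu> T x = norm (tuple_power d T \<alpha> x)" by (rule orbit_max_attained)
      have "orbit_max d \<mu> T x powr p \<le> power_sum d p T (mi_abs d \<alpha>) x"
        unfolding \<alpha>(3) by (rule norm_tuple_power_le_power_sum[OF com \<alpha>(1) refl])
      also have "\<dots> \<le> (\<Sum>k\<le>\<mu>. power_sum d p T k x)"
        using \<alpha>(2) power_sum_nonneg by (intro member_le_sum) auto
      finally show ?thesis .
    qed
    show "orbit_max d \<mu> T (T i x) \<le> orbit_max d \<mu> T x" if "i \<in> {1..d}" for i x
      using inf assms(2,3) that by (rule orbit_max_map_le)
    show "\<exists>i\<in>{1..d}. orbit_max d \<mu> T x \<le> orbit_max d \<mu> T (T i x)" for x
      using inf assms(2,3) by (rule orbit_max_le_map)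
  qed (fact assms(1) power_sum_0)+
qed

section \<open>Operator tuples that are isometric in both senses\<close>

theorem theorem3p1:
  fixes scale :: "'k::real_normed_field \<Rightarrow> 'a::real_normed_vector \<Rightarrow> 'a"
    and T :: "nat \<Rightarrow> 'a \<Rightarrow> 'a"
    and d m \<mu> :: nat
    and p :: real
  assumes "normed_space_over scale"
    and "d \<ge> 1" and "p > 0" and "\<mu> \<ge> 1"
    and "\<forall>j\<in>{1..d}. bounded_operator scale (T j)"
    and "commuting_tuple d T"
    and "mp_isometric_tuple scale d m p T"
    and "infty_isometric_tuple scale d \<mu> T"
  shows "(\<forall>j\<in>{1..d}. \<forall>x. \<forall>n\<ge>m. norm ((T j ^^ n) x) = norm ((T j ^^ m) x)) \<and>
         (mp_isometric_tuple scale d 1 p (\<lambda>j. T j ^^ m) \<and>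
          (\<forall>x. (\<Sum>j=1..d. norm ((T j ^^ m) x) powr p) = norm x powr p)) \<and>
         (\<forall>n :: nat \<Rightarrow> nat. (\<forall>j\<in>{1..d}. n j \<ge> m) \<longrightarrow>
            (\<forall>x. norm (\<Sum>j=1..d. (T j ^^ n j) x) = norm x))"
proof -
  interpret normed_space_over scale by fact
  interpret doubly_isometric_family "{1..d}" T "power_sum d p T" "orbit_max d \<mu> T" p m \<mu>
    using assms by (intro doubly_isometric_family_of_tuple)
  have lin: "Vector_Spaces.linear scale scale (T j)" if "j \<in> {1..d}" for j
    using assms(5) that by (simp add: bounded_operator_def)
  have lin_pow: "Vector_Spaces.linear scale scale (T j ^^ n)" if "j \<in> {1..d}" for j n
  proof (induction n)
    case 0
    show ?case using linear_id by (simp add: id_def)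
  next
    case (Suc n)
    then show ?case using Vector_Spaces.linear_compose[OF Suc lin[OF that]] by (simp only: funpow.simps)
  qed
  have com: "commuting_tuple d (\<lambda>j. T j ^^ m)"
    by (auto simp: commuting_tuple_def fun_eq_iff commute_funpow_funpow)
  have "mp_isometric_tuple scale d 1 p (\<lambda>j. T j ^^ m)"
    unfolding mp_isometric_tuple_iff
    using lin_pow com by (simp add: forward_diff_def power_sum_Suc power_sum_0 sum_norm_powers[simplified])
  moreover have "norm (\<Sum>j=1..d. (T j ^^ n j) x) = norm x" if "\<forall>j\<in>{1..d}. n j \<ge> m" for n x
  proof (rule norm_sum_powers)
    show "T i (x + y) = T i x + T i y" if "i \<in> {1..d}" for i x y
      using lin[OF that] by (rule module_hom.add[OF Vector_Spaces.module_hom_linearI])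
  qed (use that in blast)
  ultimately show ?thesis using norm_power_eventually_constant sum_norm_powers by blast
qed

end
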